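(* Let $v\ge k\ge 3$ and $c\ge 2$ be integers. Write $k=qc+b$ and $v=\rho c+\beta$ with integers $q,\rho$ and $0\le b<c$, $0\le\beta<c$. If there exists a block-equitably $c$-coloured packing {\rm PD}$(v,k,1)$ with $m$ blocks, then \[ m\le \frac{\rho\left(\frac{\rho c}{2}+\beta\right)(c-1)+\frac{\beta}{2}(\beta-1)}{q\left(\frac{qc}{2}+b\right)(c-1)+\frac{b}{2}(b-1)}. \]
   Context: A packing design {\rm PD}$(v,k,1)$ is a pair $(V,{\cal B})$ where $|V|=v$ and ${\cal B}$ is a collection of $k$-subsets (blocks) of $V$ such that every pair of points occurs in at most one block; its size is the number of blocks. A $c$-colouring is a function $f:V\to{\cal C}$ with $|{\cal C}|=c$, with colour classes $F(\gamma)=f^{-1}(\gamma)$; it is block-equitable if $\lfloor k/c\rfloor\le |B\cap F(\gamma)|\le\lceil k/c\rceil$ for every colour $\gamma$ and every block $B$. *)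

theory Defs
  imports Complex_Main "HOL-Library.Multiset" "HOL-Library.FuncSet"
begin

text \<open>Blocks form a multiset, so repeated blocks are not excluded by the encoding;
  an unordered pair is counted once for each occurrence of a block containing it.\<close>

definition packing_design :: "nat \<Rightarrow> nat \<Rightarrow> 'a set \<Rightarrow> 'a set multiset \<Rightarrow> bool" where
  "packing_design v k V \<B> \<longleftrightarrow>
     finite V \<and> card V = v \<and>
     (\<forall>B \<in># \<B>. B \<subseteq> V \<and> card B = k) \<and>
     (\<forall>x \<in> V. \<forall>y \<in> V. x \<noteq> y \<longrightarrow> size {#B \<in># \<B>. x \<in> B \<and> y \<in> B#} \<le> 1)"

text \<open>A colouring need not use every colour of \<open>C\<close>.\<close>

definition colouring :: "nat \<Rightarrow> 'a set \<Rightarrow> 'b set \<Rightarrow> ('a \<Rightarrow> 'b) \<Rightarrow> bool" where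
  "colouring c V C f \<longleftrightarrow> finite C \<and> card C = c \<and> f \<in> V \<rightarrow> C"

definition colour_class :: "'a set \<Rightarrow> ('a \<Rightarrow> 'b) \<Rightarrow> 'b \<Rightarrow> 'a set" where
  "colour_class V f \<gamma> = {x \<in> V. f x = \<gamma>}"

definition block_equitable ::
  "nat \<Rightarrow> nat \<Rightarrow> 'a set \<Rightarrow> 'a set multiset \<Rightarrow> 'b set \<Rightarrow> ('a \<Rightarrow> 'b) \<Rightarrow> bool" where
  "block_equitable k c V \<B> C f \<longleftrightarrow>
     (\<forall>\<gamma> \<in> C. \<forall>B \<in># \<B>.
        \<lfloor>real k / real c\<rfloor> \<le> int (card (B \<inter> colour_class V f \<gamma>)) \<and>
        int (card (B \<inter> colour_class V f \<gamma>)) \<le> \<lceil>real k / real c\<rceil>)"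

end

theory Submission
  imports Defs
begin

text \<open>
  Count ordered pairs of points with distinct colours. If a set of \<open>r * c + t\<close> points has colour
  classes of sizes \<open>n \<gamma>\<close>, the number of such pairs is that of an equitable distribution of the
  colours minus \<open>\<Sum>\<gamma>. (n \<gamma> - r) * (n \<gamma> - r - 1)\<close>. The terms of this sum are nonnegative because
  the \<open>n \<gamma>\<close> are integers, and they vanish on the blocks, whose classes have size \<open>q\<close> or \<open>q + 1\<close>.
  Since no pair lies in two blocks, the number of blocks times the count for one block is at most
  the count for the whole point set.
\<close>

definition bichromatic_pairs :: "'a set \<Rightarrow> ('a \<Rightarrow> 'b) \<Rightarrow> ('a \<times> 'a) set" where
  "bichromatic_pairs S f = {(x, y) \<in> S \<times> S. f x \<noteq> f y}"

text \<open>
  The number of \<^emph>\<open>unordered\<close> bichromatic pairs in a set of \<open>r * c + t\<close> points, \<open>0 \<le> t < c\<close>, when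
  \<open>t\<close> colour classes have \<open>r + 1\<close> points and the other \<open>c - t\<close> have \<open>r\<close> points.
\<close>

definition equitable_pairs :: "nat \<Rightarrow> int \<Rightarrow> int \<Rightarrow> real" where
  "equitable_pairs c r t =
     real_of_int r * (real_of_int r * real c / 2 + real_of_int t) * (real c - 1)
       + real_of_int t / 2 * (real_of_int t - 1)"

lemma equitable_pairs_pos:
  assumes "c \<ge> 2" "0 \<le> t" "t < int c" and two_points: "2 \<le> r * int c + t"
  shows "equitable_pairs c r t > 0"
proof -
  have "0 < (r + 1) * int c"
    using two_points \<open>t < int c\<close> by (simp add: algebra_simps)
  then have "r \<ge> 0"
    using \<open>c \<ge> 2\<close> by (simp add: zero_less_mult_iff)
  then consider (zero) "r = 0" "t \<ge> 2" | (pos) "r > 0"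
    using two_points by force
  then show ?thesis
  proof cases
    case zero
    then show ?thesis
      by (simp add: equitable_pairs_def)
  next
    case pos
    then have "real_of_int r * (real_of_int r * real c / 2 + real_of_int t) * (real c - 1) > 0"
      using \<open>c \<ge> 2\<close> \<open>0 \<le> t\<close> by (intro mult_pos_pos add_pos_nonneg) auto
    moreover have "real_of_int t / 2 * (real_of_int t - 1) \<ge> 0"
      using \<open>0 \<le> t\<close> by (cases "t = 0") auto
    ultimately show ?thesis
      by (simp add: equitable_pairs_def)
  qed
qed

lemma sum_mult_sum_diff_eq_equitable_pairs:
  fixes n :: "'b \<Rightarrow> int"
  assumes total: "sum n C = r * int (card C) + t"
  shows "real_of_int (\<Sum>\<gamma>\<in>C. n \<gamma> * (sum n C - n \<gamma>)) =
    2 * equitable_pairs (card C) r t - real_of_int (\<Sum>\<gamma>\<in>C. (n \<gamma> - r) * (n \<gamma> - r - 1))"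
proof -
  let ?s = "r * int (card C) + t"
  have "(\<Sum>\<gamma>\<in>C. n \<gamma> * (sum n C - n \<gamma>)) + (\<Sum>\<gamma>\<in>C. (n \<gamma> - r) * (n \<gamma> - r - 1)) =
      (\<Sum>\<gamma>\<in>C. (?s - 2 * r - 1) * n \<gamma> + r * (r + 1))"
    unfolding total sum.distrib[symmetric] by (intro sum.cong refl) (simp add: algebra_simps)
  also have "\<dots> = (?s - 2 * r - 1) * ?s + int (card C) * (r * (r + 1))"
    by (simp add: sum.distrib total flip: sum_distrib_left)
  finally have "real_of_int (\<Sum>\<gamma>\<in>C. n \<gamma> * (sum n C - n \<gamma>))
      + real_of_int (\<Sum>\<gamma>\<in>C. (n \<gamma> - r) * (n \<gamma> - r - 1)) =
      real_of_int ((?s - 2 * r - 1) * ?s + int (card C) * (r * (r + 1)))"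
    by (simp only: flip: of_int_add)
  also have "\<dots> = 2 * equitable_pairs (card C) r t"
    by (simp add: equitable_pairs_def field_simps)
  finally show ?thesis
    by simp
qed

lemma card_eq_sum_card_colour_class:
  assumes "finite S" "colouring c S C f"
  shows "card S = (\<Sum>\<gamma>\<in>C. card (colour_class S f \<gamma>))"
proof -
  have "finite C" "f ` S \<subseteq> C"
    using assms(2) by (auto simp: colouring_def)
  with assms(1) show ?thesis
    using sum.group[of S C f "\<lambda>_. 1 :: nat"] by (simp add: colour_class_def)
qed

lemma card_bichromatic_pairs:
  assumes "finite S" "colouring c S C f"
  shows "int (card (bichromatic_pairs S f)) =
    (\<Sum>\<gamma>\<in>C. int (card (colour_class S f \<gamma>))
             * (int (card S) - int (card (colour_class S f \<gamma>))))"
proof -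
  let ?n = "\<lambda>\<gamma>. int (card (colour_class S f \<gamma>))"
  have "bichromatic_pairs S f = (SIGMA x:S. S - colour_class S f (f x))"
    by (auto simp: bichromatic_pairs_def colour_class_def)
  then have "int (card (bichromatic_pairs S f)) = (\<Sum>x\<in>S. int (card (S - colour_class S f (f x))))"
    using \<open>finite S\<close> by simp
  also have "\<dots> = (\<Sum>x\<in>S. int (card S) - ?n (f x))"
    using \<open>finite S\<close> by (intro sum.cong refl)
      (simp add: colour_class_def card_Diff_subset card_mono)
  also have "\<dots> = (\<Sum>\<gamma>\<in>C. \<Sum>x | x \<in> S \<and> f x = \<gamma>. int (card S) - ?n (f x))"
    using assms by (intro sum.group[symmetric]) (auto simp: colouring_def)
  also have "\<dots> = (\<Sum>\<gamma>\<in>C. ?n \<gamma> * (int (card S) - ?n \<gamma>))"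
    by (intro sum.cong refl) (simp add: colour_class_def)
  finally show ?thesis .
qed

lemma card_bichromatic_pairs_eq_equitable_pairs_diff:
  assumes "finite S" "colouring c S C f" "int (card S) = r * int c + t"
  shows "real (card (bichromatic_pairs S f)) = 2 * equitable_pairs c r t
    - real_of_int (\<Sum>\<gamma>\<in>C. (int (card (colour_class S f \<gamma>)) - r)
                            * (int (card (colour_class S f \<gamma>)) - r - 1))"
proof -
  let ?n = "\<lambda>\<gamma>. int (card (colour_class S f \<gamma>))"
  have size: "sum ?n C = int (card S)"
    using card_eq_sum_card_colour_class[OF assms(1,2)] by simp
  have colours: "card C = c"
    using assms(2) by (simp add: colouring_def)
  have "real (card (bichromatic_pairs S f)) = real_of_int (\<Sum>\<gamma>\<in>C. ?n \<gamma> * (sum ?n C - ?n \<gamma>))"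
    unfolding size card_bichromatic_pairs[OF assms(1,2), symmetric]
    by (rule of_int_of_nat_eq[symmetric])
  also have "\<dots> = 2 * equitable_pairs c r t
      - real_of_int (\<Sum>\<gamma>\<in>C. (?n \<gamma> - r) * (?n \<gamma> - r - 1))"
    using sum_mult_sum_diff_eq_equitable_pairs[of ?n C r t] assms(3) unfolding size colours by blast
  finally show ?thesis .
qed

lemma card_bichromatic_pairs_le:
  assumes "finite S" "colouring c S C f" "int (card S) = r * int c + t"
  shows "real (card (bichromatic_pairs S f)) \<le> 2 * equitable_pairs c r t"
proof -
  have "0 \<le> z * (z - 1)" for z :: int
    by (cases "z \<le> 0") (auto intro: mult_nonpos_nonpos)
  then show ?thesis
    unfolding card_bichromatic_pairs_eq_equitable_pairs_diff[OF assms]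
    by (simp add: sum_nonneg del: of_int_sum of_int_mult)
qed

lemma card_bichromatic_pairs_equitable:
  assumes "finite S" "colouring c S C f" "int (card S) = r * int c + t"
    and "\<And>\<gamma>. \<gamma> \<in> C \<Longrightarrow> int (card (colour_class S f \<gamma>)) \<in> {r, r + 1}"
  shows "real (card (bichromatic_pairs S f)) = 2 * equitable_pairs c r t"
proof -
  have "(\<Sum>\<gamma>\<in>C. (int (card (colour_class S f \<gamma>)) - r)
                  * (int (card (colour_class S f \<gamma>)) - r - 1)) = 0"
    using assms(4) by (intro sum.neutral) force
  then show ?thesis
    unfolding card_bichromatic_pairs_eq_equitable_pairs_diff[OF assms(1-3)] by simp
qed

lemma block_equitable_card_colour_class:
  assumes "block_equitable k c V \<B> C f" "B \<in># \<B>" "B \<subseteq> V" "\<gamma> \<in> C"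
  shows "card (colour_class B f \<gamma>) \<in> {k div c, k div c + 1}"
proof -
  have "colour_class B f \<gamma> = B \<inter> colour_class V f \<gamma>"
    using \<open>B \<subseteq> V\<close> by (auto simp: colour_class_def)
  moreover have floor: "\<lfloor>real k / real c\<rfloor> = int (k div c)"
    by (rule floor_divide_of_nat_eq)
  moreover have "\<lceil>real k / real c\<rceil> \<le> int (k div c) + 1"
    using ceiling_diff_floor_le_1[of "real k / real c"] floor by simp
  ultimately have "int (k div c) \<le> int (card (colour_class B f \<gamma>))"
    "int (card (colour_class B f \<gamma>)) \<le> int (k div c) + 1"
    using assms(1,2,4) by (fastforce simp: block_equitable_def)+
  then show ?thesis
    by auto
qed

lemma card_bichromatic_pairs_block:
  assumes "packing_design v k V \<B>" "colouring c V C f" "block_equitable k c V \<B> C f"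
    and "int k = q * int c + b" "0 \<le> b" "b < int c" and "B \<in># \<B>"
  shows "real (card (bichromatic_pairs B f)) = 2 * equitable_pairs c q b"
proof (rule card_bichromatic_pairs_equitable)
  have block: "B \<subseteq> V" "card B = k" "finite B"
    using assms(1,7) by (auto simp: packing_design_def intro: finite_subset)
  then show "finite B" "int (card B) = q * int c + b"
    using assms(4) by simp_all
  show "colouring c B C f"
    using assms(2) \<open>B \<subseteq> V\<close> by (auto simp: colouring_def)
  have "q = int (k div c)"
    using int_div_pos_eq[OF _ assms(5,6)] assms(4) by (simp add: mult.commute zdiv_int)
  then show "int (card (colour_class B f \<gamma>)) \<in> {q, q + 1}" if "\<gamma> \<in> C" for \<gamma>
    using block_equitable_card_colour_class[OF assms(3,7) \<open>B \<subseteq> V\<close> that] by auto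
qed

lemma sum_mset_card_eq_sum_size_filter:
  assumes "finite P"
  shows "(\<Sum>B\<in>#\<B>. card {p \<in> P. R p B}) = (\<Sum>p\<in>P. size {#B \<in># \<B>. R p B#})"
proof (induction \<B>)
  case (add B \<B>)
  have "(\<Sum>p\<in>P. size {#D \<in># add_mset B \<B>. R p D#}) =
      (\<Sum>p\<in>P. of_bool (R p B) + size {#D \<in># \<B>. R p D#})"
    by (intro sum.cong) auto
  also have "\<dots> = card {p \<in> P. R p B} + (\<Sum>p\<in>P. size {#D \<in># \<B>. R p D#})"
    using assms by (simp add: sum.distrib Int_def)
  finally show ?case
    using add by simp
qed simp

lemma packing_design_sum_card_pairs_le:
  assumes "packing_design v k V \<B>" and P: "P \<subseteq> V \<times> V - Id"
  shows "(\<Sum>B\<in>#\<B>. card (P \<inter> B \<times> B)) \<le> card P"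
proof -
  let ?R = "\<lambda>p B. fst p \<in> B \<and> snd p \<in> B"
  have "finite P"
    by (rule finite_subset[of _ "V \<times> V"]) (use assms in \<open>auto simp: packing_design_def\<close>)
  have "P \<inter> B \<times> B = {p \<in> P. ?R p B}" for B
    by auto
  then have "(\<Sum>B\<in>#\<B>. card (P \<inter> B \<times> B)) = (\<Sum>p\<in>P. size {#B \<in># \<B>. ?R p B#})"
    using sum_mset_card_eq_sum_size_filter[OF \<open>finite P\<close>, of ?R \<B>] by simp
  also have "\<dots> \<le> (\<Sum>p\<in>P. 1)"
  proof (rule sum_mono)
    show "size {#B \<in># \<B>. ?R p B#} \<le> 1" if "p \<in> P" for p
    proof -
      have "fst p \<in> V" "snd p \<in> V" "fst p \<noteq> snd p"
        using P that by auto
      then show ?thesis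
        using assms(1) by (simp add: packing_design_def)
    qed
  qed
  finally show ?thesis
    by simp
qed

lemma sum_card_bichromatic_pairs_blocks_le:
  assumes "packing_design v k V \<B>"
  shows "(\<Sum>B\<in>#\<B>. card (bichromatic_pairs B f)) \<le> card (bichromatic_pairs V f)"
proof -
  have "bichromatic_pairs B f = bichromatic_pairs V f \<inter> B \<times> B" if "B \<in># \<B>" for B
    using assms that by (auto simp: packing_design_def bichromatic_pairs_def)
  then have "(\<Sum>B\<in>#\<B>. card (bichromatic_pairs B f)) =
      (\<Sum>B\<in>#\<B>. card (bichromatic_pairs V f \<inter> B \<times> B))"
    by (intro arg_cong[of _ _ sum_mset] image_mset_cong) simp
  also have "\<dots> \<le> card (bichromatic_pairs V f)"
    using assms by (rule packing_design_sum_card_pairs_le) (auto simp: bichromatic_pairs_def)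
  finally show ?thesis .
qed

theorem theorem2p8:
  fixes v k c m :: nat and q b \<rho> \<beta> :: int
    and V :: "'a set" and \<B> :: "'a set multiset"
    and C :: "'b set" and f :: "'a \<Rightarrow> 'b"
  assumes "v \<ge> k" and "k \<ge> 3" and "c \<ge> 2"
    and "int k = q * int c + b" and "0 \<le> b" and "b < int c"
    and "int v = \<rho> * int c + \<beta>" and "0 \<le> \<beta>" and "\<beta> < int c"
    and "packing_design v k V \<B>"
    and "colouring c V C f"
    and "block_equitable k c V \<B> C f"
    and "size \<B> = m"
  shows "real m \<le>
    (real_of_int \<rho> * (real_of_int \<rho> * real c / 2 + real_of_int \<beta>) * (real c - 1)
       + real_of_int \<beta> / 2 * (real_of_int \<beta> - 1)) /
    (real_of_int q * (real_of_int q * real c / 2 + real_of_int b) * (real c - 1)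
       + real_of_int b / 2 * (real_of_int b - 1))"
proof -
  have "real m * (2 * equitable_pairs c q b) = (\<Sum>B\<in>#\<B>. 2 * equitable_pairs c q b)"
    using \<open>size \<B> = m\<close> by simp
  also have "\<dots> = (\<Sum>B\<in>#\<B>. real (card (bichromatic_pairs B f)))"
    using card_bichromatic_pairs_block[OF assms(10-12) assms(4-6)]
    by (intro arg_cong[of _ _ sum_mset] image_mset_cong) simp
  also have "\<dots> = real (\<Sum>B\<in>#\<B>. card (bichromatic_pairs B f))"
    by (simp add: image_mset.compositionality comp_def)
  also have "\<dots> \<le> real (card (bichromatic_pairs V f))"
    using sum_card_bichromatic_pairs_blocks_le[OF assms(10)] by (rule of_nat_mono)
  also have "\<dots> \<le> 2 * equitable_pairs c \<rho> \<beta>"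
    using assms(7,10,11)
    by (intro card_bichromatic_pairs_le) (auto simp: packing_design_def)
  finally have "real m * equitable_pairs c q b \<le> equitable_pairs c \<rho> \<beta>"
    by simp
  moreover have "equitable_pairs c q b > 0"
    using assms(2-6) by (intro equitable_pairs_pos) simp_all
  ultimately have "real m \<le> equitable_pairs c \<rho> \<beta> / equitable_pairs c q b"
    by (simp add: pos_le_divide_eq)
  then show ?thesis
    unfolding equitable_pairs_def .
qed

end
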